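(* Let $f_1, f_2\colon \mathbb{R}^n\to [-\infty,\infty]$ be proper nearly convex functions. Suppose that $$\mathrm{ri}(\mathrm{dom}\, f_1)\cap \mathrm{ri}(\mathrm{dom}\, f_2)\neq \emptyset.$$ Then $f_1+f_2$ is nearly convex.
   Context: A set $\Omega\subset\mathbb{R}^k$ is nearly convex if there exists a convex set $C\subset\mathbb{R}^k$ such that $C\subset\Omega\subset\overline{C}$, where $\overline{C}$ is the closure of $C$. For an arbitrary set $\Omega\subset\mathbb{R}^k$, the relative interior is $\mathrm{ri}\,\Omega=\{a\in\Omega \mid \text{there exists } \delta>0 \text{ with } B(a;\delta)\cap \mathrm{aff}\,\Omega\subset\Omega\}$, where $\mathrm{aff}\,\Omega$ is the affine hull and $B(a;\delta)$ the open ball. For $f\colon\mathbb{R}^n\to[-\infty,\infty]$, $\mathrm{dom}\,f=\{x\mid f(x)<\infty\}$ and $\mathrm{epi}\,f=\{(x,\lambda)\in\mathbb{R}^n\times\mathbb{R}\mid f(x)\le\lambda\}$. The function $f$ is proper if $\mathrm{dom}\,f\neq\emptyset$ and $f(x)>-\infty$ for all $x$; it is nearly convex if $\mathrm{epi}\,f$ is a nearly convex set in $\mathbb{R}^n\times\mathbb{R}$. *)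

theory Defs
  imports "HOL-Analysis.Analysis"
begin

definition nearly_convex :: "'a::euclidean_space set \<Rightarrow> bool" where
  "nearly_convex S \<longleftrightarrow> (\<exists>C. convex C \<and> C \<subseteq> S \<and> S \<subseteq> closure C)"

definition eff_dom :: "('a \<Rightarrow> ereal) \<Rightarrow> 'a set" where
  "eff_dom f = {x. f x < \<infinity>}"

(* The second coordinate is real, not extended real, so that epi f lies in the
   Euclidean space 'a \<times> real. The library's epigraph covers real-valued functions only. *)
definition epi :: "('a \<Rightarrow> ereal) \<Rightarrow> ('a \<times> real) set" where
  "epi f = {(x, l). f x \<le> ereal l}"

definition proper_fun :: "('a \<Rightarrow> ereal) \<Rightarrow> bool" where
  "proper_fun f \<longleftrightarrow> eff_dom f \<noteq> {} \<and> (\<forall>x. f x > -\<infinity>)"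

definition nearly_convex_fun :: "('a::euclidean_space \<Rightarrow> ereal) \<Rightarrow> bool" where
  "nearly_convex_fun f \<longleftrightarrow> nearly_convex (epi f)"

end

theory Submission
  imports Defs
begin

text \<open>
  If \<open>C\<^sub>i\<close> is a convex set witnessing that \<open>epi f\<^sub>i\<close> is nearly convex, then
  \<open>ri (dom f\<^sub>i)\<close> is contained in the projection of \<open>ri C\<^sub>i\<close>. Hence a point of
  \<open>ri (dom f\<^sub>1) \<inter> ri (dom f\<^sub>2)\<close> lies below points of both \<open>ri C\<^sub>1\<close> and \<open>ri C\<^sub>2\<close>, and the fibrewise
  sum of \<open>ri C\<^sub>1\<close> and \<open>ri C\<^sub>2\<close> is a nonempty convex subset of \<open>epi (f\<^sub>1 + f\<^sub>2)\<close>. It is dense there,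
  because the open segment from a point of \<open>ri C\<^sub>i\<close> to a point of \<open>closure C\<^sub>i\<close> stays in \<open>ri C\<^sub>i\<close>.
\<close>

text \<open>Partial addition of sets, in the second coordinate only. On epigraphs it plays the part
  of adding functions, as \<open>epi_add\<close> shows.\<close>

definition fibre_sum :: "('a \<times> 'b) set \<Rightarrow> ('a \<times> 'b) set \<Rightarrow> ('a \<times> 'b::plus) set" where
  "fibre_sum A B = {(x, a + b) | x a b. (x, a) \<in> A \<and> (x, b) \<in> B}"

lemma fibre_sumI: "(x, a) \<in> A \<Longrightarrow> (x, b) \<in> B \<Longrightarrow> (x, a + b) \<in> fibre_sum A B"
  unfolding fibre_sum_def by blast

lemma fibre_sumE:
  assumes "p \<in> fibre_sum A B"
  obtains x a b where "p = (x, a + b)" "(x, a) \<in> A" "(x, b) \<in> B"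
  using assms unfolding fibre_sum_def by blast

lemma convex_fibre_sum:
  fixes A B :: "('a::real_vector \<times> 'b::real_vector) set"
  assumes "convex A" "convex B"
  shows "convex (fibre_sum A B)"
proof (rule convexI)
  fix p q and u v :: real
  assume p: "p \<in> fibre_sum A B" and q: "q \<in> fibre_sum A B"
    and uv: "0 \<le> u" "0 \<le> v" "u + v = 1"
  obtain x a b where p': "p = (x, a + b)" "(x, a) \<in> A" "(x, b) \<in> B"
    using p by (rule fibre_sumE)
  obtain y c d where q': "q = (y, c + d)" "(y, c) \<in> A" "(y, d) \<in> B"
    using q by (rule fibre_sumE)
  have "(u *\<^sub>R x + v *\<^sub>R y, u *\<^sub>R a + v *\<^sub>R c) \<in> A"
    using convexD[OF assms(1) p'(2) q'(2) uv] by simp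
  moreover have "(u *\<^sub>R x + v *\<^sub>R y, u *\<^sub>R b + v *\<^sub>R d) \<in> B"
    using convexD[OF assms(2) p'(3) q'(3) uv] by simp
  ultimately have "(u *\<^sub>R x + v *\<^sub>R y, (u *\<^sub>R a + v *\<^sub>R c) + (u *\<^sub>R b + v *\<^sub>R d)) \<in> fibre_sum A B"
    by (rule fibre_sumI)
  then show "u *\<^sub>R p + v *\<^sub>R q \<in> fibre_sum A B"
    by (simp add: p'(1) q'(1) algebra_simps)
qed

text \<open>The two base points share the first coordinate \<open>x0\<close>, and the two end points
  share \<open>x\<close>. Segments run at the same parameter therefore stay over a common first
  coordinate, so their points can be added fibrewise.\<close>

lemma fibre_sum_closure_subset:
  fixes A B :: "('a::euclidean_space \<times> 'b::euclidean_space) set"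
  assumes "convex A" "convex B"
    and x0: "(x0, a0) \<in> rel_interior A" "(x0, b0) \<in> rel_interior B"
  shows "fibre_sum (closure A) (closure B) \<subseteq> closure (fibre_sum (rel_interior A) (rel_interior B))"
    (is "_ \<subseteq> closure ?R")
proof
  fix q assume "q \<in> fibre_sum (closure A) (closure B)"
  then obtain x a b where q: "q = (x, a + b)" and ab: "(x, a) \<in> closure A" "(x, b) \<in> closure B"
    by (rule fibre_sumE)
  define p where "p = (x0, a0 + b0)"
  have p: "p \<in> ?R"
    unfolding p_def using x0 by (rule fibre_sumI)
  have "open_segment p q \<subseteq> ?R"
  proof
    fix z assume "z \<in> open_segment p q"
    then obtain u where u: "0 < u" "u < 1" and z: "z = (1 - u) *\<^sub>R p + u *\<^sub>R q"
      by (auto simp: in_segment)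
    have shrink: "(1 - u) *\<^sub>R c + u *\<^sub>R y \<in> rel_interior S"
      if "convex S" "c \<in> rel_interior S" "y \<in> closure S"
      for c y :: "'a \<times> 'b" and S
      \<comment> \<open>The library form is \<open>y - e *\<^sub>R (y - c)\<close> with 0 < e \<le>
        1; here e = 1 - u.\<close>
      using rel_interior_closure_convex_shrink[OF that, of "1 - u"] u
      by (simp add: algebra_simps)
    have "((1 - u) *\<^sub>R x0 + u *\<^sub>R x, (1 - u) *\<^sub>R a0 + u *\<^sub>R a) \<in> rel_interior A"
      using shrink[OF assms(1) x0(1) ab(1)] by simp
    moreover have "((1 - u) *\<^sub>R x0 + u *\<^sub>R x, (1 - u) *\<^sub>R b0 + u *\<^sub>R b) \<in> rel_interior B"
      using shrink[OF assms(2) x0(2) ab(2)] by simp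
    ultimately have "((1 - u) *\<^sub>R x0 + u *\<^sub>R x,
        ((1 - u) *\<^sub>R a0 + u *\<^sub>R a) + ((1 - u) *\<^sub>R b0 + u *\<^sub>R b)) \<in> ?R"
      by (rule fibre_sumI)
    then show "z \<in> ?R"
      by (simp add: z p_def q algebra_simps)
  qed
  then have "closure (open_segment p q) \<subseteq> closure ?R"
    by (rule closure_mono)
  then show "q \<in> closure ?R"
    \<comment> \<open>The open segment is empty when \<open>p = q\<close>, but then \<open>q\<close>
      already lies in \<open>?R\<close>; otherwise its closure contains the endpoint
      \<open>q\<close>.\<close>
    using p closure_subset[of ?R] by (cases "p = q") auto
qed

text \<open>Relative interior is monotone only between sets with the same affine hull. Here
  \<open>S\<close> and \<open>closure C\<close> both have the affine hull of \<open>C\<close>, and a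
  convex set has the same relative interior as its closure.\<close>

lemma rel_interior_subset_of_between_closure:
  fixes C S :: "'a::euclidean_space set"
  assumes "convex C" "C \<subseteq> S" "S \<subseteq> closure C"
  shows "rel_interior S \<subseteq> rel_interior C"
proof -
  have "affine hull S = affine hull (closure C)"
    using hull_mono[OF assms(2), of affine] hull_mono[OF assms(3), of affine]
      closure_same_affine_hull[of C] by auto
  then have "rel_interior S \<subseteq> rel_interior (closure C)"
    by (rule rel_interior_mono[OF assms(3)])
  then show ?thesis
    using convex_rel_interior_closure[OF assms(1)] by simp
qed

lemma eff_dom_eq_fst_epi:
  assumes "\<And>x. f x > -\<infinity>"
  shows "eff_dom f = fst ` epi f"
proof
  show "eff_dom f \<subseteq> fst ` epi f"
  proof
    fix x assume "x \<in> eff_dom f"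
    then obtain r where "f x = ereal r"
      using assms[of x] by (cases "f x") (auto simp: eff_dom_def)
    then have "(x, r) \<in> epi f"
      by (simp add: epi_def)
    then show "x \<in> fst ` epi f"
      by force
  qed
  show "fst ` epi f \<subseteq> eff_dom f"
    by (auto simp: eff_dom_def epi_def)
qed

text \<open>The inclusions between \<open>C\<close>, \<open>epi f\<close> and
  \<open>closure C\<close> survive projection, since a linear map sends a closure into the closure
  of the image. For the convex set \<open>C\<close>, projection also commutes with relative
  interior, which yields the height \<open>r\<close>.\<close>

lemma rel_interior_eff_dom_lift:
  fixes f :: "'a::euclidean_space \<Rightarrow> ereal"
  assumes "\<And>x. f x > -\<infinity>"
    and C: "convex C" "C \<subseteq> epi f" "epi f \<subseteq> closure C"
    and x: "x \<in> rel_interior (eff_dom f)"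
  obtains r where "(x, r) \<in> rel_interior C"
proof -
  have "fst ` epi f \<subseteq> closure (fst ` C)"
    using closure_linear_image_subset[OF linear_fst, of C] C(3) by blast
  then have "rel_interior (eff_dom f) \<subseteq> rel_interior (fst ` C)"
    unfolding eff_dom_eq_fst_epi[OF assms(1)]
    by (intro rel_interior_subset_of_between_closure convex_linear_image linear_fst image_mono C)
  also have "\<dots> = fst ` rel_interior C"
    by (rule rel_interior_convex_linear_image[OF linear_fst C(1), symmetric])
  finally show thesis
    using x that by force
qed

lemma epi_add:
  assumes f: "\<And>x. f x > -\<infinity>" and g: "\<And>x. g x > -\<infinity>"
  shows "epi (\<lambda>x. f x + g x) = fibre_sum (epi f) (epi g)"
proof
  show "epi (\<lambda>x. f x + g x) \<subseteq> fibre_sum (epi f) (epi g)"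
  proof
    fix p assume "p \<in> epi (\<lambda>x. f x + g x)"
    then obtain x l where p: "p = (x, l)" and le: "f x + g x \<le> ereal l"
      by (auto simp: epi_def)
    \<comment> \<open>A sum bounded by a real, with neither term -\<infinity>, has both terms
      finite.\<close>
    obtain a b where ab: "f x = ereal a" "g x = ereal b"
      using f[of x] g[of x] le by (cases "f x"; cases "g x") auto
    \<comment> \<open>The first summand takes its exact value and the second absorbs all the
      slack.\<close>
    have "(x, a + (l - a)) \<in> fibre_sum (epi f) (epi g)"
      using le by (intro fibre_sumI) (auto simp: epi_def ab)
    then show "p \<in> fibre_sum (epi f) (epi g)"
      by (simp add: p)
  qed
  show "fibre_sum (epi f) (epi g) \<subseteq> epi (\<lambda>x. f x + g x)"
    by (force elim!: fibre_sumE simp: epi_def simp flip: plus_ereal.simps(1) intro: add_mono)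
qed

lemma fibre_sum_mono: "A \<subseteq> A' \<Longrightarrow> B \<subseteq> B' \<Longrightarrow> fibre_sum A B \<subseteq> fibre_sum A' B'"
  unfolding fibre_sum_def by blast

theorem corollary4p3:
  fixes f1 f2 :: "real ^ 'n \<Rightarrow> ereal"
  assumes "proper_fun f1" and "nearly_convex_fun f1"
    and "proper_fun f2" and "nearly_convex_fun f2"
    and "rel_interior (eff_dom f1) \<inter> rel_interior (eff_dom f2) \<noteq> {}"
  shows "nearly_convex_fun (\<lambda>x. f1 x + f2 x)"
proof -
  have f1: "\<And>x. f1 x > -\<infinity>" and f2: "\<And>x. f2 x > -\<infinity>"
    using assms(1,3) by (auto simp: proper_fun_def)
  obtain C1 where C1: "convex C1" "C1 \<subseteq> epi f1" "epi f1 \<subseteq> closure C1"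
    using assms(2) by (auto simp: nearly_convex_fun_def nearly_convex_def)
  obtain C2 where C2: "convex C2" "C2 \<subseteq> epi f2" "epi f2 \<subseteq> closure C2"
    using assms(4) by (auto simp: nearly_convex_fun_def nearly_convex_def)
  obtain x0 where x0: "x0 \<in> rel_interior (eff_dom f1)" "x0 \<in> rel_interior (eff_dom f2)"
    using assms(5) by blast
  \<comment> \<open>The heights \<open>a0\<close> and \<open>b0\<close> are unrelated; what matters
    for density is that both points lie over the same \<open>x0\<close>.\<close>
  obtain a0 where a0: "(x0, a0) \<in> rel_interior C1"
    using rel_interior_eff_dom_lift[OF f1 C1 x0(1)] .
  obtain b0 where b0: "(x0, b0) \<in> rel_interior C2"
    using rel_interior_eff_dom_lift[OF f2 C2 x0(2)] .
  let ?C = "fibre_sum (rel_interior C1) (rel_interior C2)"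
  have "convex ?C"
    by (intro convex_fibre_sum convex_rel_interior C1 C2)
  moreover have "?C \<subseteq> fibre_sum (epi f1) (epi f2)"
    using rel_interior_subset C1(2) C2(2) by (intro fibre_sum_mono) blast+
  moreover have "fibre_sum (epi f1) (epi f2) \<subseteq> closure ?C"
    using fibre_sum_mono[OF C1(3) C2(3)] fibre_sum_closure_subset[OF C1(1) C2(1) a0 b0]
    by (rule subset_trans)
  ultimately show ?thesis
    unfolding nearly_convex_fun_def nearly_convex_def epi_add[OF f1 f2] by blast
qed

end
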